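(* Let $\mu$ and $\widetilde\mu$ be finite positive measures supported in a common compact subset of $(0,\infty)$. If $G_\mu(r)=G_{\widetilde\mu}(r)$ for all $r$ in some nonempty open subinterval of $(0,\infty)$, then $\mu=\widetilde\mu$.
   Context: For a finite positive (Borel) measure $\mu$ supported in a compact subset of $(0,\infty)$, \[ G_\mu(r)=\int_0^\infty\int_0^\infty\frac{\mu(\mathrm dy)\,\mu(\mathrm dv)}{\bigl(r^2+(y+v)^2\bigr)^2},\qquad r>0 . \] *)

theory Defs
  imports "HOL-Analysis.Analysis"
begin

text \<open>Measures on the half-line are represented as Borel measures on the whole real line
  that give no mass to the complement of a set \<open>K\<close> contained in the half-line; the zero measure
  is allowed.\<close>

definition finite_borel_measure_supported_in :: "real measure \<Rightarrow> real set \<Rightarrow> bool" where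
  "finite_borel_measure_supported_in \<mu> K \<longleftrightarrow>
     finite_measure \<mu> \<and> sets \<mu> = sets borel \<and> emeasure \<mu> (- K) = 0"

text \<open>For \<open>r > 0\<close> and a finite Borel measure the integrand is nonnegative and bounded by
  \<open>1 / r ^ 4\<close>, so both Bochner integrals are genuine.\<close>

definition G :: "real measure \<Rightarrow> real \<Rightarrow> real" where
  "G \<mu> r = (LINT y:{0<..}|\<mu>. LINT v:{0<..}|\<mu>. 1 / (r\<^sup>2 + (y + v)\<^sup>2)\<^sup>2)"

end

theory Submission
  imports Defs "HOL-Complex_Analysis.Cauchy_Integral_Formula"
begin

text \<open>
  Put \<open>s = y + v\<close> and \<open>w = 1 / (r\<^sub>0\<^sup>2 + s\<^sup>2)\<close> for a point \<open>r\<^sub>0\<close> of the interval. Replacing \<open>r\<^sup>2\<close> by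
  \<open>r\<^sub>0\<^sup>2 - x\<close> turns the kernel into \<open>(w / (1 - x w))\<^sup>2 = (\<Sum>k. (k + 1) w\<^bsup>k + 2\<^esup> x\<^bsup>k\<^esup>)\<close>, so equality of
  \<open>G\<close> near \<open>r\<^sub>0\<close> gives equality of all integrals of \<open>w\<^bsup>k + 2\<^esup>\<close> under the two product measures.
  Since \<open>s\<close> is a continuous function of \<open>w\<close> and \<open>w\<close> stays in a compact subset of the half-line,
  Weierstrass approximation yields equality of the integrals of \<open>exp (- n s)\<close>, which are the
  squares of the nonnegative integrals of \<open>exp (- n y)\<close> under the measures themselves. A second Weierstrass
  approximation, by polynomials in \<open>exp (- y)\<close>, separates the measures.
\<close>

section \<open>Power series: termwise integration and uniqueness of coefficients\<close>

text \<open>Differentiating the geometric series expands the integrand pointwise. The majorant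
  \<open>?b\<close> is constant in \<open>z\<close>, hence integrable over a finite measure, and is
  summable in \<open>k\<close> because \<open>\<bar>x\<bar> * B < 1\<close>; so sum and integral may
  be interchanged.\<close>

lemma integral_geometric_deriv_sums:
  fixes w :: "'a \<Rightarrow> real"
  assumes M: "finite_measure M" and w[measurable]: "w \<in> borel_measurable M"
    and bd: "AE z in M. \<bar>w z\<bar> \<le> B" and x: "\<bar>x\<bar> * B < 1" and B: "0 \<le> B"
  shows "(\<lambda>k. (real (Suc k) * (LINT z|M. (w z)\<^sup>2 * w z ^ k)) * x ^ k) sums
    (LINT z|M. (w z / (1 - x * w z))\<^sup>2)"
proof -
  interpret finite_measure M by fact
  let ?f = "\<lambda>k z. real (Suc k) * ((w z)\<^sup>2 * w z ^ k) * x ^ k"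
  let ?b = "\<lambda>k. real (Suc k) * (\<bar>x\<bar> * B) ^ k * B\<^sup>2"
  have bound: "\<bar>?f k z\<bar> \<le> ?b k" if "\<bar>w z\<bar> \<le> B" for k z
  proof -
    have "\<bar>w z\<bar> ^ k \<le> B ^ k" "\<bar>w z\<bar> ^ 2 \<le> B\<^sup>2"
      by (rule power_mono[OF that abs_ge_zero])+
    then have "\<bar>w z\<bar> ^ 2 * \<bar>w z\<bar> ^ k \<le> B\<^sup>2 * B ^ k"
      by (intro mult_mono) auto
    then have "(real (Suc k) * \<bar>x\<bar> ^ k) * (\<bar>w z\<bar> ^ 2 * \<bar>w z\<bar> ^ k) \<le> (real (Suc k) * \<bar>x\<bar> ^ k) * (B\<^sup>2 * B ^ k)"
      by (intro mult_left_mono) auto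
    then show ?thesis
      by (simp add: abs_mult power_abs power_mult_distrib mult_ac)
  qed
  have b_summable: "summable ?b"
    using geometric_deriv_sums[of "\<bar>x\<bar> * B"] x B
    by (intro summable_mult2) (auto simp: sums_iff)
  have int: "integrable M (?f k)" for k
  proof (rule integrable_const_bound[of _ "?b k"])
    show "AE z in M. norm (?f k z) \<le> ?b k"
      using bd by eventually_elim (unfold real_norm_def, rule bound)
  qed measurable
  have summ: "summable (\<lambda>k. norm (?f k z))" if "\<bar>w z\<bar> \<le> B" for z
    by (rule summable_comparison_test'[OF b_summable, of 0])
       (use bound[OF that] in simp)
  have "(\<lambda>k. integral\<^sup>L M (?f k)) sums (LINT z|M. (\<Sum>k. ?f k z))"
  proof (rule sums_integral[OF int])
    show "AE z in M. summable (\<lambda>k. norm (?f k z))"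
      using bd by eventually_elim (rule summ)
    show "summable (\<lambda>k. LINT z|M. norm (?f k z))"
    proof (rule summable_comparison_test'[of "\<lambda>k. ?b k * measure M (space M)" 0])
      show "summable (\<lambda>k. ?b k * measure M (space M))"
        by (intro summable_mult2 b_summable)
      fix k :: nat
      have "(LINT z|M. norm (?f k z)) \<le> (LINT z|M. ?b k)"
      proof (rule integral_mono_AE)
        show "AE z in M. norm (?f k z) \<le> ?b k"
          using bd by eventually_elim (unfold real_norm_def, rule bound)
      qed (use int integrable_norm in blast)+
      then show "norm (LINT z|M. norm (?f k z)) \<le> ?b k * measure M (space M)"
        by (simp add: mult.commute)
    qed
  qed
  moreover have "(LINT z|M. (\<Sum>k. ?f k z)) = (LINT z|M. (w z / (1 - x * w z))\<^sup>2)"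
  proof (rule integral_cong_AE)
    show "AE z in M. (\<Sum>k. ?f k z) = (w z / (1 - x * w z))\<^sup>2"
      using bd
    proof eventually_elim
      case (elim z)
      have "\<bar>x\<bar> * \<bar>w z\<bar> \<le> \<bar>x\<bar> * B"
        using elim by (intro mult_left_mono) auto
      then have "norm (x * w z) < 1"
        using x by (simp add: abs_mult)
      from sums_mult[OF geometric_deriv_sums[OF this], of "(w z)\<^sup>2"]
      have "(\<lambda>k. ?f k z) sums ((w z)\<^sup>2 * (1 / (1 - x * w z)\<^sup>2))"
        by (simp add: power_mult_distrib mult_ac)
      then show ?case by (simp add: sums_iff power_divide)
    qed
  qed measurable
  moreover have "integral\<^sup>L M (?f k) = real (Suc k) * (LINT z|M. (w z)\<^sup>2 * w z ^ k) * x ^ k" for k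
    by simp
  ultimately show ?thesis by simp
qed

text \<open>The difference of the two series vanishes identically near 0, whereas a power series
  with a nonzero coefficient has only isolated zeros.\<close>

lemma powser_coeff_unique:
  fixes a b :: "nat \<Rightarrow> real"
  assumes e: "0 < e"
    and a: "\<And>x. \<bar>x\<bar> < e \<Longrightarrow> (\<lambda>k. a k * x ^ k) sums F x"
    and b: "\<And>x. \<bar>x\<bar> < e \<Longrightarrow> (\<lambda>k. b k * x ^ k) sums F x"
  shows "a = b"
proof (rule ccontr)
  assume "a \<noteq> b"
  then obtain m where m: "a m - b m \<noteq> 0" by (auto simp: fun_eq_iff)
  have s: "(\<lambda>k. (a k - b k) * x ^ k) sums 0" if "\<bar>x\<bar> < e" for x
    using sums_diff[OF a[OF that] b[OF that]] by (simp add: algebra_simps)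
  \<comment> \<open>The constant term is read off at \<open>x = 0\<close>; isolation of zeros then
    needs a nonzero coefficient of positive index.\<close>
  have "a 0 - b 0 = 0"
    using sums_unique2[OF s[of 0] powser_sums_zero] e by simp
  with m have "m > 0" by (cases m) auto
  show False
  proof (rule powser_0_nonzero[of e 0 "\<lambda>k. a k - b k" "\<lambda>_. 0::real" m])
    fix d :: real
    assume "0 < d" and "\<And>z::real. z \<in> cball 0 d - {0} \<Longrightarrow> (0::real) \<noteq> 0"
    from this(2)[of d] this(1) show False by simp
  next
    show "(\<lambda>n. (a n - b n) * (x - 0) ^ n) sums 0" if "norm (x - 0) < e" for x
      using s that by simp
  qed (fact e m \<open>m > 0\<close> refl)+
qed

section \<open>Weierstrass approximation: moments determine integrals\<close>

lemma integrable_bounded_mult_compose: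
  fixes h f g :: "_ \<Rightarrow> real"
  assumes M: "finite_measure M" and [measurable]: "h \<in> borel_measurable M" "f \<in> borel_measurable M"
    and h: "AE z in M. \<bar>h z\<bar> \<le> H" and f: "AE z in M. f z \<in> S"
    and S: "compact S" "continuous_on S g" and g[measurable]: "g \<in> borel_measurable borel"
  shows "integrable M (\<lambda>z. h z * g (f z))"
proof -
  have "bounded (g ` S)"
    using S compact_continuous_image compact_imp_bounded by blast
  then obtain C where C: "\<And>x. x \<in> S \<Longrightarrow> \<bar>g x\<bar> \<le> C"
    by (auto simp: bounded_real)
  have "AE z in M. norm (h z * g (f z)) \<le> H * C"
    using h f
  proof eventually_elim
    case (elim z)
    then have "\<bar>h z\<bar> * \<bar>g (f z)\<bar> \<le> H * C"
      by (intro mult_mono C) auto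
    then show ?case by (simp add: abs_mult)
  qed
  then show ?thesis
    by (intro finite_measure.integrable_const_bound[OF M, where B = "H * C"]) auto
qed

lemma integral_compose_diff_le:
  fixes h f g p :: "_ \<Rightarrow> real"
  assumes M: "finite_measure M" and [measurable]: "h \<in> borel_measurable M" "f \<in> borel_measurable M"
    and h: "AE z in M. \<bar>h z\<bar> \<le> H" and f: "AE z in M. f z \<in> S"
    and S: "compact S" and g: "continuous_on S g" "g \<in> borel_measurable borel"
    and p: "continuous_on S p" "p \<in> borel_measurable borel"
    and e: "\<And>x. x \<in> S \<Longrightarrow> \<bar>g x - p x\<bar> \<le> e"
  shows "\<bar>(LINT z|M. h z * g (f z)) - (LINT z|M. h z * p (f z))\<bar> \<le> e * (LINT z|M. \<bar>h z\<bar>)"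
proof -
  note i = integrable_bounded_mult_compose[OF M assms(2,3) h f S]
  have ih: "integrable M h"
    using h by (intro finite_measure.integrable_const_bound[OF M, where B = H]) auto
  have "\<bar>(LINT z|M. h z * g (f z)) - (LINT z|M. h z * p (f z))\<bar>
      = \<bar>LINT z|M. h z * g (f z) - h z * p (f z)\<bar>"
    by (subst Bochner_Integration.integral_diff) (auto intro: i g p)
  also have "\<dots> \<le> (LINT z|M. \<bar>h z * g (f z) - h z * p (f z)\<bar>)"
    by (rule integral_abs_bound)
  also have "\<dots> \<le> (LINT z|M. e * \<bar>h z\<bar>)"
  proof (rule integral_mono_AE)
    show "AE z in M. \<bar>h z * g (f z) - h z * p (f z)\<bar> \<le> e * \<bar>h z\<bar>"
      using f
    proof eventually_elim
      case (elim z)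
      have "\<bar>h z\<bar> * \<bar>g (f z) - p (f z)\<bar> \<le> \<bar>h z\<bar> * e"
        by (intro mult_left_mono e elim) auto
      then show ?case by (simp add: abs_mult right_diff_distrib[symmetric] mult.commute)
    qed
  qed (use ih in \<open>auto intro!: integrable_abs Bochner_Integration.integrable_diff i g p\<close>)
  finally show ?thesis by simp
qed

text \<open>A polynomial uniformly \<open>e\<close>-close to \<open>g\<close> on \<open>S\<close>
  has equal integrals under both measures, since these are combinations of the moments, and
  replacing \<open>g\<close> by it costs at most \<open>e\<close> times the integral of
  \<open>\<bar>h z\<bar>\<close>. The weight \<open>h\<close> allows for moments known only from
  some power on: it is used with the square of \<open>w\<close>, and again with the constant
  1.\<close>

lemma moments_determine_integrals:
  fixes h f g :: "_ \<Rightarrow> real"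
  assumes M: "finite_measure M" and N: "finite_measure N" and sets: "sets M = sets N"
    and hm: "h \<in> borel_measurable M" and fm: "f \<in> borel_measurable M"
    and hM: "AE z in M. \<bar>h z\<bar> \<le> H" and hN: "AE z in N. \<bar>h z\<bar> \<le> H"
    and fM: "AE z in M. f z \<in> S" and fN: "AE z in N. f z \<in> S"
    and S: "compact S" and g: "continuous_on S g" "g \<in> borel_measurable borel"
    and mom: "\<And>k. (LINT z|M. h z * f z ^ k) = (LINT z|N. h z * f z ^ k)"
  shows "(LINT z|M. h z * g (f z)) = (LINT z|N. h z * g (f z))"
proof -
  have hm': "h \<in> borel_measurable N" and fm': "f \<in> borel_measurable N"
    using hm fm measurable_cong_sets[OF sets refl] by auto
  define C where "C = (LINT z|M. \<bar>h z\<bar>) + (LINT z|N. \<bar>h z\<bar>)"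
  have C: "C \<ge> 0" by (simp add: C_def)
  have le: "\<bar>(LINT z|M. h z * g (f z)) - (LINT z|N. h z * g (f z))\<bar> \<le> e * C" if e: "e > 0" for e
  proof -
    obtain p where "real_polynomial_function p" and pe: "\<And>x. x \<in> S \<Longrightarrow> \<bar>g x - p x\<bar> < e"
      using Stone_Weierstrass_real_polynomial_function[OF S g(1) e] by auto
    then obtain a n where p: "p = (\<lambda>x. \<Sum>i\<le>n. a i * x ^ i)"
      using real_polynomial_function_iff_sum by blast
    have pc: "continuous_on S p" and pm: "p \<in> borel_measurable borel"
      unfolding p by (auto intro!: continuous_intros)
    have M': "(LINT z|L. h z * p (f z)) = (\<Sum>i\<le>n. a i * (LINT z|L. h z * f z ^ i))"
      if L: "finite_measure L" "h \<in> borel_measurable L" "f \<in> borel_measurable L"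
        "AE z in L. \<bar>h z\<bar> \<le> H" "AE z in L. f z \<in> S" for L
    proof -
      have i: "integrable L (\<lambda>z. h z * f z ^ i)" for i
        by (rule integrable_bounded_mult_compose[OF L S, of "\<lambda>x. x ^ i"]) (auto intro!: continuous_intros)
      have "(LINT z|L. h z * p (f z)) = (LINT z|L. (\<Sum>i\<le>n. a i * (h z * f z ^ i)))"
        by (simp add: p sum_distrib_left mult_ac)
      also have "\<dots> = (\<Sum>i\<le>n. a i * (LINT z|L. h z * f z ^ i))"
        using i by (subst Bochner_Integration.integral_sum) auto
      finally show ?thesis .
    qed
    have "(LINT z|M. h z * p (f z)) = (LINT z|N. h z * p (f z))"
      by (simp add: M'[OF M hm fm hM fM] M'[OF N hm' fm' hN fN] mom)
    moreover have "\<bar>(LINT z|M. h z * g (f z)) - (LINT z|M. h z * p (f z))\<bar> \<le> e * (LINT z|M. \<bar>h z\<bar>)"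
      using integral_compose_diff_le[OF M hm fm hM fM S g pc pm] pe less_imp_le by blast
    moreover have "\<bar>(LINT z|N. h z * g (f z)) - (LINT z|N. h z * p (f z))\<bar> \<le> e * (LINT z|N. \<bar>h z\<bar>)"
      using integral_compose_diff_le[OF N hm' fm' hN fN S g pc pm] pe less_imp_le by blast
    ultimately show ?thesis
      by (simp add: C_def distrib_left)
  qed
  have "\<bar>(LINT z|M. h z * g (f z)) - (LINT z|N. h z * g (f z))\<bar> \<le> 0"
  proof (rule field_le_epsilon)
    fix e :: real assume "e > 0"
    \<comment> \<open>\<open>C\<close> may be zero, so the tolerance is divided by
      \<open>C + 1\<close>.\<close>
    then have "e / (C + 1) > 0" "e / (C + 1) * C \<le> e"
      using C by (auto simp: field_simps)
    with le[of "e / (C + 1)"] show "\<bar>(LINT z|M. h z * g (f z)) - (LINT z|N. h z * g (f z))\<bar> \<le> 0 + e"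
      by linarith
  qed
  then show ?thesis by simp
qed

section \<open>Continuous functions separate finite Borel measures\<close>

text \<open>Indicators of open half-lines are pointwise limits of continuous functions with values
  in [0,1]. Dominated convergence carries the equality over to half-lines, and these determine a
  finite measure.\<close>

lemma finite_borel_measure_eqI_continuous:
  fixes M N :: "real measure"
  assumes M: "finite_measure M" and N: "finite_measure N"
    and sets: "sets M = sets borel" "sets N = sets borel"
    and eq: "\<And>g :: real \<Rightarrow> real. continuous_on UNIV g \<Longrightarrow> integral\<^sup>L M g = integral\<^sup>L N g"
  shows "M = N"
proof (rule measure_eqI_lessThan[OF sets])
  fix x :: real
  interpret M: finite_measure M by fact
  interpret N: finite_measure N by fact
  show "emeasure M {x<..} < \<infinity>"
    using M.emeasure_finite[of "{x<..}"] by (simp add: less_top[symmetric])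
  \<comment> \<open>For positive \<open>n\<close> this ramp climbs from 0 at \<open>x\<close> to 1
    at \<open>x + 1/n\<close>. It is 0 at \<open>x\<close> itself, so the limit is the indicator of
    the open half-line.\<close>
  define g where "g n y = min 1 (max 0 (real n * (y - x)))" for n y
  have g: "continuous_on UNIV (g n)" for n
    unfolding g_def by (intro continuous_intros)
  have gm: "g n \<in> borel_measurable borel" for n
    using g by (rule borel_measurable_continuous_onI)
  have lim: "(\<lambda>n. g n y) \<longlonglongrightarrow> indicator {x<..} y" for y
  proof (cases "y > x")
    case True
    obtain m :: nat where m: "1 / (y - x) < real m" using reals_Archimedean2 by blast
    have "g n y = 1" if "n \<ge> m" for n
    proof -
      have "1 / (y - x) \<le> real n" using m that by linarith
      then have "1 \<le> real n * (y - x)" using True by (simp add: field_simps)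
      then show ?thesis by (simp add: g_def)
    qed
    then have "\<forall>\<^sub>F n in sequentially. g n y = 1"
      by (auto simp: eventually_sequentially)
    with True show ?thesis by (simp add: tendsto_eventually)
  next
    case False
    then have "g n y = 0" for n
      by (simp add: g_def mult_nonneg_nonpos)
    with False show ?thesis by simp
  qed
  have L: "(\<lambda>n. integral\<^sup>L L (g n)) \<longlonglongrightarrow> measure L {x<..}"
    if L: "finite_measure L" "sets L = sets borel" for L
  proof -
    interpret finite_measure L by fact
    have [measurable]: "g n \<in> borel_measurable L" for n
      using gm by (simp only: measurable_cong_sets[OF L(2) refl])
    have A: "{x<..} \<in> sets L" by (simp add: L)
    have "(\<lambda>n. integral\<^sup>L L (g n)) \<longlonglongrightarrow> integral\<^sup>L L (indicator {x<..} :: real \<Rightarrow> real)"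
      by (rule integral_dominated_convergence[where w = "\<lambda>_. 1"])
         (use A lim in \<open>simp_all add: g_def\<close>)
    then show ?thesis using A by (simp add: sets.Int_space_eq2)
  qed
  have "measure M {x<..} = measure N {x<..}"
    by (rule LIMSEQ_unique[OF L[OF M sets(1)] L[OF N sets(2), folded eq[OF g]]])
  then show "emeasure M {x<..} = emeasure N {x<..}"
    by (simp add: M.emeasure_eq_measure N.emeasure_eq_measure)
qed

section \<open>Measures supported in a compact subset of the half-line, and their product
  squares\<close>

context
  fixes \<mu> :: "real measure" and K :: "real set"
  assumes \<mu>: "finite_borel_measure_supported_in \<mu> K" and K: "compact K" "K \<subseteq> {0<..}"
begin

lemma supported_finite: "finite_measure \<mu>" and supported_sets [measurable_cong]: "sets \<mu> = sets borel"
  using \<mu> by (auto simp: finite_borel_measure_supported_in_def)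

lemma supported_AE: "AE y in \<mu>. y \<in> K"
proof (rule AE_I)
  show "{y \<in> space \<mu>. y \<notin> K} \<subseteq> - K" by auto
  show "emeasure \<mu> (- K) = 0" using \<mu> by (simp add: finite_borel_measure_supported_in_def)
  show "- K \<in> sets \<mu>" using K(1) by (simp add: supported_sets borel_compact borel_comp)
qed

lemma supported_pair_sigma_finite: "pair_sigma_finite \<mu> \<mu>"
  using supported_finite by (simp add: pair_sigma_finite_def finite_measure_def)

lemma supported_pair_finite: "finite_measure (\<mu> \<Otimes>\<^sub>M \<mu>)"
  using supported_finite by (intro finite_measure_pair_measure)

lemma supported_pair_sets: "sets (\<mu> \<Otimes>\<^sub>M \<mu>) = sets (borel \<Otimes>\<^sub>M borel)"
  by (intro sets_pair_measure_cong supported_sets)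

lemma supported_pair_AE: "AE z in \<mu> \<Otimes>\<^sub>M \<mu>. fst z \<in> K \<and> snd z \<in> K"
proof (rule pair_sigma_finite.AE_pair_measure[OF supported_pair_sigma_finite])
  have [measurable]: "K \<in> sets borel" using K by (simp add: borel_compact)
  show "{z \<in> space (\<mu> \<Otimes>\<^sub>M \<mu>). fst z \<in> K \<and> snd z \<in> K} \<in> sets (\<mu> \<Otimes>\<^sub>M \<mu>)"
    by measurable
  show "AE x in \<mu>. AE y in \<mu>. fst (x, y) \<in> K \<and> snd (x, y) \<in> K"
    using supported_AE
  proof eventually_elim
    case (elim x)
    show ?case using supported_AE by eventually_elim (simp add: elim)
  qed
qed

lemma set_integral_supported:
  fixes f :: "real \<Rightarrow> real"
  assumes [measurable]: "f \<in> borel_measurable borel"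
  shows "(LINT y:{0<..}|\<mu>. f y) = (LINT y|\<mu>. f y)"
  unfolding set_lebesgue_integral_def
proof (rule integral_cong_AE)
  show "AE y in \<mu>. indicator {0<..} y *\<^sub>R f y = f y"
    using supported_AE by eventually_elim (use K(2) in auto)
qed measurable

text \<open>Fubini applies because the kernel is bounded by \<open>1 / (r\<^sup>2)\<^sup>2\<close>
  and the product measure is finite. In this form \<open>G\<close> is a single integral, to which
  the series expansion applies.\<close>

lemma G_eq_pair_integral:
  assumes "r > 0"
  shows "G \<mu> r = (LINT z|(\<mu> \<Otimes>\<^sub>M \<mu>). 1 / (r\<^sup>2 + (fst z + snd z)\<^sup>2)\<^sup>2)"
proof -
  interpret P: pair_sigma_finite \<mu> \<mu> by (rule supported_pair_sigma_finite)
  interpret F: finite_measure "\<mu> \<Otimes>\<^sub>M \<mu>" by (rule supported_pair_finite)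
  have "integrable (\<mu> \<Otimes>\<^sub>M \<mu>) (\<lambda>z. 1 / (r\<^sup>2 + (fst z + snd z)\<^sup>2)\<^sup>2)"
  proof (intro F.integrable_const_bound[where B = "1 / (r\<^sup>2)\<^sup>2"] AE_I2)
    fix z :: "real \<times> real"
    have "(r\<^sup>2)\<^sup>2 \<le> (r\<^sup>2 + (fst z + snd z)\<^sup>2)\<^sup>2"
      by (intro power_mono) auto
    then have "1 / (r\<^sup>2 + (fst z + snd z)\<^sup>2)\<^sup>2 \<le> 1 / (r\<^sup>2)\<^sup>2"
      using \<open>r > 0\<close> by (intro divide_left_mono mult_pos_pos) (auto intro!: add_pos_nonneg zero_less_power)
    then show "norm (1 / (r\<^sup>2 + (fst z + snd z)\<^sup>2)\<^sup>2) \<le> 1 / (r\<^sup>2)\<^sup>2"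
      by simp
  qed measurable
  from P.integral_fst'[OF this] show ?thesis
    unfolding G_def
    by (subst set_integral_supported, measurable)
       (subst set_integral_supported, auto)
qed

text \<open>The exponential of a sum factorises, so by Fubini the double integral is a product of
  two equal integrals. Integrability holds for either sign of \<open>c\<close>, because
  \<open>fst z + snd z\<close> almost surely lies in a compact set.\<close>

lemma integral_exp_add:
  "(LINT z|(\<mu> \<Otimes>\<^sub>M \<mu>). exp (- c * (fst z + snd z))) = (LINT y|\<mu>. exp (- c * y))\<^sup>2"
proof -
  interpret P: pair_sigma_finite \<mu> \<mu> by (rule supported_pair_sigma_finite)
  have "integrable (\<mu> \<Otimes>\<^sub>M \<mu>) (\<lambda>z. 1 * exp (- c * (fst z + snd z)))"
  proof -
    have f: "AE z in \<mu> \<Otimes>\<^sub>M \<mu>. z \<in> K \<times> K"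
      using supported_pair_AE by eventually_elim (auto simp: mem_Times_iff)
    have "compact ((\<lambda>z. fst z + snd z) ` (K \<times> K))"
      using K by (intro compact_continuous_image compact_Times continuous_intros)
    moreover have "AE z in \<mu> \<Otimes>\<^sub>M \<mu>. fst z + snd z \<in> (\<lambda>z. fst z + snd z) ` (K \<times> K)"
      using f by eventually_elim blast
    ultimately show ?thesis
      by (intro integrable_bounded_mult_compose[OF supported_pair_finite, where H = 1
            and f = "\<lambda>z. fst z + snd z" and g = "\<lambda>s. exp (- c * s)"])
         (auto intro!: continuous_intros)
  qed
  then have "(LINT z|(\<mu> \<Otimes>\<^sub>M \<mu>). exp (- c * (fst z + snd z)))
      = (LINT x|\<mu>. LINT y|\<mu>. exp (- c * (x + y)))"
    by (subst P.integral_fst'[symmetric]) simp_all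
  also have "(\<lambda>x. LINT y|\<mu>. exp (- c * (x + y))) = (\<lambda>x. exp (- c * x) * (LINT y|\<mu>. exp (- c * y)))"
    by (simp only: distrib_left exp_add integral_mult_right_zero)
  finally show ?thesis
    by (simp only: integral_mult_left_zero power2_eq_square)
qed

end

section \<open>Recovering the measure from its kernel integral\<close>

theorem theorem1p4:
  fixes \<mu> \<mu>' :: "real measure" and K I :: "real set"
  assumes "compact K" and "K \<subseteq> {0<..}"
    and "finite_borel_measure_supported_in \<mu> K"
    and "finite_borel_measure_supported_in \<mu>' K"
    and "open I" and "is_interval I" and "I \<noteq> {}" and "I \<subseteq> {0<..}"
    and "\<And>r. r \<in> I \<Longrightarrow> G \<mu> r = G \<mu>' r"
  shows "\<mu> = \<mu>'"
proof -
  note K = assms(1,2) and m = assms(3,4)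
  let ?P = "\<mu> \<Otimes>\<^sub>M \<mu>" and ?P' = "\<mu>' \<Otimes>\<^sub>M \<mu>'"
  obtain r0 where r0: "r0 \<in> I" using assms by blast
  then have "r0 > 0" using assms by auto
  define t where "t = r0\<^sup>2"
  have t: "t > 0" using \<open>r0 > 0\<close> by (simp add: t_def)
  obtain b where b: "\<And>y. y \<in> K \<Longrightarrow> \<bar>y\<bar> \<le> b"
    using compact_imp_bounded[OF K(1)] by (auto simp: bounded_real)
  define w where "w z = 1 / (t + (fst z + snd z)\<^sup>2)" for z :: "real \<times> real"
  \<comment> \<open>This interval contains the values of \<open>w\<close> on
    \<open>K \<times> K\<close>, where the sum of the coordinates is at most \<open>2 * b\<close> in
    absolute value. Its lower end is positive, which later keeps the inverse of \<open>w\<close>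
    continuous.\<close>
  define S where "S = {1 / (t + (2 * b)\<^sup>2) .. 1 / t}"
  have wm: "w \<in> borel_measurable (borel \<Otimes>\<^sub>M borel)"
    unfolding w_def by measurable
  have w_bound: "\<bar>w z\<bar> \<le> 1 / t" for z
    using t by (auto simp: w_def intro!: divide_left_mono mult_pos_pos add_pos_nonneg)
  have w_S: "w z \<in> S" if "fst z \<in> K \<and> snd z \<in> K" for z
  proof -
    have "(fst z + snd z)\<^sup>2 \<le> (2 * b)\<^sup>2"
      using b[of "fst z"] b[of "snd z"] that by (intro abs_le_square_iff[THEN iffD1]) auto
    then have "1 / (t + (2 * b)\<^sup>2) \<le> w z"
      using t unfolding w_def
      by (auto intro!: divide_left_mono mult_pos_pos add_pos_nonneg)
    then show ?thesis using w_bound[of z] by (simp add: S_def)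
  qed
  \<comment> \<open>With radius \<open>sqrt (t - x)\<close> and \<open>s = fst z + snd z\<close>,
    the denominator before squaring is \<open>t + s\<^sup>2 - x\<close>, that is
    \<open>(1 - x * w z) / w z\<close>.\<close>
  have G_w: "G \<nu> (sqrt (t - x)) = (LINT z|(\<nu> \<Otimes>\<^sub>M \<nu>). (w z / (1 - x * w z))\<^sup>2)"
    if \<nu>: "finite_borel_measure_supported_in \<nu> K" and x: "x < t" for \<nu> x
  proof -
    have "1 / (t - x + s\<^sup>2)\<^sup>2 = (1 / (t + s\<^sup>2) / (1 - x * (1 / (t + s\<^sup>2))))\<^sup>2" for s
    proof -
      have "t + s\<^sup>2 > 0" using t by (simp add: add_pos_nonneg)
      then have "1 / (t + s\<^sup>2) / (1 - x * (1 / (t + s\<^sup>2))) = 1 / (t - x + s\<^sup>2)"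
        by (simp add: divide_simps)
      then show ?thesis by (simp add: power_divide)
    qed
    then show ?thesis
      using G_eq_pair_integral[OF \<nu> K, of "sqrt (t - x)"] x by (simp add: w_def)
  qed
  have "open ((\<lambda>x. sqrt (t - x)) -` I)"
    using \<open>open I\<close> by (rule open_vimage) (intro continuous_intros)
  moreover have "0 \<in> (\<lambda>x. sqrt (t - x)) -` I"
    using r0 \<open>r0 > 0\<close> by (simp add: t_def)
  ultimately obtain e0 where e0: "e0 > 0" "ball 0 e0 \<subseteq> (\<lambda>x. sqrt (t - x)) -` I"
    by (meson openE)
  \<comment> \<open>\<open>e0\<close> keeps \<open>sqrt (t - x)\<close> inside \<open>I\<close>. The
    bound \<open>t\<close> makes \<open>t - x\<close> positive and, as \<open>w\<close> is at most
    \<open>1 / t\<close>, gives convergence of the series.\<close>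
  define e where "e = min e0 t"
  have e: "e > 0" using e0 t by (simp add: e_def)
  define a where "a \<nu> k = real (Suc k) * (LINT z|(\<nu> \<Otimes>\<^sub>M \<nu>). (w z)\<^sup>2 * w z ^ k)" for \<nu> k
  have series: "(\<lambda>k. a \<nu> k * x ^ k) sums G \<nu> (sqrt (t - x))"
    if \<nu>: "finite_borel_measure_supported_in \<nu> K" and x: "\<bar>x\<bar> < e" for \<nu> x
  proof -
    have "w \<in> borel_measurable (\<nu> \<Otimes>\<^sub>M \<nu>)"
      using wm by (simp add: measurable_cong_sets[OF supported_pair_sets[OF \<nu> K] refl])
    moreover have "\<bar>x\<bar> * (1 / t) < 1" using x t by (simp add: e_def)
    ultimately show ?thesis
      using integral_geometric_deriv_sums[OF supported_pair_finite[OF \<nu> K], of w "1 / t" x]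
        w_bound t x by (simp add: a_def G_w[OF \<nu>] e_def)
  qed
  have "a \<mu> = a \<mu>'"
  proof (rule powser_coeff_unique[OF e series[OF m(1)]])
    fix x assume x: "\<bar>x\<bar> < e"
    then have "x \<in> ball 0 e0" by (simp add: e_def)
    then have "sqrt (t - x) \<in> I" using e0 by auto
    then show "(\<lambda>k. a \<mu>' k * x ^ k) sums G \<mu> (sqrt (t - x))"
      using series[OF m(2) x] assms(9) by simp
  qed
  \<comment> \<open>The factor \<open>real (Suc k)\<close> in the coefficients is nonzero and
    cancels.\<close>
  then have mom: "(LINT z|?P. (w z)\<^sup>2 * w z ^ k) = (LINT z|?P'. (w z)\<^sup>2 * w z ^ k)" for k
    by (auto simp: a_def dest: fun_cong[of _ _ k])
  have exp_eq: "(LINT y|\<mu>. exp (- real n * y)) = (LINT y|\<mu>'. exp (- real n * y))" for n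
  proof -
    \<comment> \<open>\<open>sqrt (1 / x - t)\<close> solves \<open>x = 1 / (t + s\<^sup>2)\<close>
      for nonnegative \<open>s\<close>; the division by \<open>x\<^sup>2\<close> compensates the
      weight \<open>(w z)\<^sup>2\<close>.\<close>
    define g where "g x = exp (- real n * sqrt (1 / x - t)) / x\<^sup>2" for x
    have pos: "x > 0" if "x \<in> S" for x
    proof -
      have "0 < 1 / (t + (2 * b)\<^sup>2)" using t by (simp add: add_pos_nonneg)
      also have "\<dots> \<le> x" using that by (simp add: S_def)
      finally show ?thesis .
    qed
    have g_w: "(w z)\<^sup>2 * g (w z) = exp (- real n * (fst z + snd z))" if "fst z \<in> K \<and> snd z \<in> K" for z
    proof -
      \<comment> \<open>Positivity of the support makes the square root return the sum itself rather
        than its absolute value.\<close>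
      have "fst z + snd z > 0" using that K by (auto intro!: add_pos_pos)
      moreover have "w z > 0" using t by (simp add: w_def add_pos_nonneg)
      ultimately show ?thesis
        by (simp add: g_def) (simp add: w_def)
    qed
    have gc: "continuous_on S g"
      unfolding g_def using pos by (auto intro!: continuous_intros simp: less_imp_neq[symmetric])
    have gm: "g \<in> borel_measurable borel"
      unfolding g_def by measurable
    have *: "(LINT z|(\<nu> \<Otimes>\<^sub>M \<nu>). (w z)\<^sup>2 * g (w z)) = (LINT y|\<nu>. exp (- real n * y))\<^sup>2"
      if \<nu>: "finite_borel_measure_supported_in \<nu> K" for \<nu>
    proof -
      note [measurable] = wm gm
      have "(LINT z|(\<nu> \<Otimes>\<^sub>M \<nu>). (w z)\<^sup>2 * g (w z)) = (LINT z|(\<nu> \<Otimes>\<^sub>M \<nu>). exp (- real n * (fst z + snd z)))"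
      proof (rule integral_cong_AE)
        show "AE z in \<nu> \<Otimes>\<^sub>M \<nu>. (w z)\<^sup>2 * g (w z) = exp (- real n * (fst z + snd z))"
          using supported_pair_AE[OF \<nu> K] by eventually_elim (rule g_w)
      qed (unfold measurable_cong_sets[OF supported_pair_sets[OF \<nu> K] refl], measurable)
      then show ?thesis by (simp only: integral_exp_add[OF \<nu> K])
    qed
    have "(LINT z|?P. (w z)\<^sup>2 * g (w z)) = (LINT z|?P'. (w z)\<^sup>2 * g (w z))"
    proof (rule moments_determine_integrals[OF _ _ _ _ _ _ _ _ _ _ gc gm mom])
      show "sets ?P = sets ?P'" by (simp only: supported_pair_sets[OF m(1) K] supported_pair_sets[OF m(2) K])
      show w': "w \<in> borel_measurable ?P"
        using wm by (simp add: measurable_cong_sets[OF supported_pair_sets[OF m(1) K] refl])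
      then show "(\<lambda>z. (w z)\<^sup>2) \<in> borel_measurable ?P" by measurable
      have "\<bar>(w z)\<^sup>2\<bar> \<le> (1 / t)\<^sup>2" for z
        using power_mono[OF w_bound[of z], of 2] by simp
      then show "AE z in ?P. \<bar>(w z)\<^sup>2\<bar> \<le> (1 / t)\<^sup>2" "AE z in ?P'. \<bar>(w z)\<^sup>2\<bar> \<le> (1 / t)\<^sup>2"
        by auto
      show "AE z in ?P. w z \<in> S"
        using supported_pair_AE[OF m(1) K] by eventually_elim (rule w_S)
      show "AE z in ?P'. w z \<in> S"
        using supported_pair_AE[OF m(2) K] by eventually_elim (rule w_S)
      show "compact S" by (simp add: S_def)
    qed (auto intro: supported_pair_finite[OF m(1) K] supported_pair_finite[OF m(2) K])
    \<comment> \<open>The squares of the two integrals agree, and both integrals are nonnegative, so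
      no sign ambiguity remains.\<close>
    then show ?thesis
      by (simp add: *[OF m(1)] *[OF m(2)] power2_eq_iff_nonneg integral_nonneg_AE)
  qed
  show ?thesis
  proof (rule finite_borel_measure_eqI_continuous)
    fix g :: "real \<Rightarrow> real" assume g: "continuous_on UNIV g"
    \<comment> \<open>The new variable is \<open>exp (- y)\<close>, whose \<open>k\<close>-th
      moments are the integrals compared in \<open>exp_eq\<close>. A continuous \<open>g\<close> is
      recovered as the function \<open>g (- ln x)\<close> of this variable, continuous on
      \<open>S'\<close> because \<open>S'\<close> consists of positive numbers.\<close>
    define S' where "S' = (\<lambda>y::real. exp (- y)) ` K"
    have S': "compact S'"
      unfolding S'_def using K by (intro compact_continuous_image continuous_intros)
    have S'_pos: "x > 0" if "x \<in> S'" for x using that by (auto simp: S'_def)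
    have g_ln: "continuous_on S' (\<lambda>x. g (- ln x))"
      using S'_pos by (intro continuous_on_compose2[OF g] continuous_intros) force+
    have [measurable]: "g \<in> borel_measurable borel"
      using g by (rule borel_measurable_continuous_onI)
    have "(LINT y|\<mu>. 1 * g (- ln (exp (- y)))) = (LINT y|\<mu>'. 1 * g (- ln (exp (- y))))"
    proof (rule moments_determine_integrals[OF _ _ _ _ _ _ _ _ _ S' g_ln])
      show "sets \<mu> = sets \<mu>'" by (simp only: supported_sets[OF m(1) K] supported_sets[OF m(2) K])
      show "(\<lambda>y. exp (- y)) \<in> borel_measurable \<mu>"
        by (simp add: measurable_cong_sets[OF supported_sets[OF m(1) K] refl])
      show "AE y in \<mu>. exp (- y) \<in> S'"
        using supported_AE[OF m(1) K] by eventually_elim (auto simp: S'_def)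
      show "AE y in \<mu>'. exp (- y) \<in> S'"
        using supported_AE[OF m(2) K] by eventually_elim (auto simp: S'_def)
      show "(LINT y|\<mu>. 1 * exp (- y) ^ k) = (LINT y|\<mu>'. 1 * exp (- y) ^ k)" for k
        using exp_eq[of k]
        by (simp only: mult_1_left exp_of_nat_mult[symmetric] mult_minus_left mult_minus_right)
    qed (auto intro: supported_finite[OF m(1) K] supported_finite[OF m(2) K])
    then show "integral\<^sup>L \<mu> g = integral\<^sup>L \<mu>' g" by simp
  qed (fact supported_finite[OF m(1) K] supported_finite[OF m(2) K]
        supported_sets[OF m(1) K] supported_sets[OF m(2) K])+
qed

end
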